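(* Let $\mathbb{F}_q$ be a finite field with $q$ elements and let $L$ be a finite-dimensional non-abelian Lie algebra over $\mathbb{F}_q$ with $\dim Z(L)\geq 1$. Then $$d(L)\leq \frac{q^{2}+q-1}{q^{3}}.$$
   Context: For a finite-dimensional Lie algebra $L$ over the finite field $\mathbb{F}_q$ (so $L$ is a finite set), the commutativity degree of $L$ is $d(L)=\dfrac{|\{(x,y)\in L\times L \mid [x,y]=0\}|}{|L|^{2}}$. Here $Z(L)=\{z\in L\mid [z,x]=0 \text{ for all } x\in L\}$ is the center of $L$. *)

theory Defs
  imports Complex_Main
begin

text \<open>The underlying vector space is the whole type \<open>'a\<close>, as in the library locale
  \<^locale>\<open>vector_space\<close>. The bracket is required to be alternating, not merely
  antisymmetric, so that characteristic 2 is treated correctly.\<close>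

locale lie_algebra = vector_space scale
  for scale :: "'k::field \<Rightarrow> 'a::ab_group_add \<Rightarrow> 'a" (infixr "*s" 75) +
  fixes bracket :: "'a \<Rightarrow> 'a \<Rightarrow> 'a"
  assumes bracket_add_left: "bracket (x + y) z = bracket x z + bracket y z"
    and bracket_add_right: "bracket x (y + z) = bracket x y + bracket x z"
    and bracket_scale_left: "bracket (c *s x) y = c *s bracket x y"
    and bracket_scale_right: "bracket x (c *s y) = c *s bracket x y"
    and bracket_self: "bracket x x = 0"
    and jacobi: "bracket x (bracket y z) + bracket y (bracket z x) + bracket z (bracket x y) = 0"

definition lie_abelian :: "('a \<Rightarrow> 'a \<Rightarrow> 'a::zero) \<Rightarrow> bool" where
  "lie_abelian bracket \<longleftrightarrow> (\<forall>x y. bracket x y = 0)"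

definition lie_center :: "('a \<Rightarrow> 'a \<Rightarrow> 'a::zero) \<Rightarrow> 'a set" where
  "lie_center bracket = {z. \<forall>x. bracket z x = 0}"

text \<open>Only meaningful when \<open>'a\<close> is finite, which holds for a finite-dimensional
  Lie algebra over a finite field.\<close>

definition commutativity_degree :: "('a \<Rightarrow> 'a \<Rightarrow> 'a::zero) \<Rightarrow> real" where
  "commutativity_degree bracket =
     real (card {(x, y). bracket x y = 0}) / real (card (UNIV :: 'a set)) ^ 2"

end

theory Submission
  imports Defs
begin

text \<open>The centralizer of a non-central element \<open>x\<close> is a proper subspace of \<open>L\<close>, and it properly
  contains the center because it contains \<open>x\<close>. Hence each such centralizer has at most
  \<open>|L|/q\<close> elements and the center at most \<open>|L|/q\<^sup>2\<close>. Counting commuting pairs by their first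
  component gives \<open>d(L) \<le> 1/q + (1 - 1/q) |Z(L)|/|L|\<close>, which is at most the claimed bound.\<close>

text \<open>For \<open>v\<close> in \<open>T\<close> outside \<open>S\<close>, the line through
  \<open>v\<close> and \<open>S\<close> have a direct sum inside \<open>T\<close>, and counting its
  elements requires no basis. Here \<open>'a\<close> is the scalar field; in
  \<open>lie_algebra\<close> it is the type of vectors.\<close>

lemma (in vector_space) card_proper_subspace_le:
  assumes S: "subspace S" and T: "subspace T" and "S \<subset> T" and "finite T"
  shows "card (UNIV :: 'a set) * card S \<le> card T"
proof -
  obtain v where v: "v \<in> T" "v \<notin> S"
    using \<open>S \<subset> T\<close> by blast
  define f where "f = (\<lambda>(c, x). c *s v + x)"
  have "inj_on f (UNIV \<times> S)"
  proof (rule inj_onI, clarsimp simp: f_def)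
    fix c d x y
    assume xy: "x \<in> S" "y \<in> S" and eq: "c *s v + x = d *s v + y"
    have diff: "(c - d) *s v = y - x"
      using eq by (simp add: scale_left_diff_distrib algebra_simps)
    \<comment> \<open>Otherwise dividing by \<open>c - d\<close> would place \<open>v\<close> in
      \<open>S\<close>.\<close>
    have "c = d"
    proof (rule ccontr)
      assume "c \<noteq> d"
      then have "v = inverse (c - d) *s (y - x)"
        by (simp flip: diff)
      then show False
        using v S xy by (simp add: subspace_scale subspace_diff)
    qed
    then show "c = d \<and> x = y"
      using eq by simp
  qed
  moreover have "f ` (UNIV \<times> S) \<subseteq> T"
    using v T \<open>S \<subset> T\<close> by (auto simp: f_def intro!: subspace_add subspace_scale)
  ultimately have "card ((UNIV :: 'a set) \<times> S) \<le> card T"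
    using \<open>finite T\<close> by (rule card_inj_on_le)
  then show ?thesis
    by (simp add: card_cartesian_product)
qed

definition lie_centralizer :: "('a \<Rightarrow> 'a \<Rightarrow> 'a::zero) \<Rightarrow> 'a \<Rightarrow> 'a set" where
  "lie_centralizer bracket x = {y. bracket x y = 0}"

context lie_algebra
begin

lemma bracket_zero [simp]: "bracket 0 x = 0" "bracket x 0 = 0"
  using bracket_add_left[of 0 0 x] bracket_add_right[of x 0 0] by simp_all

lemma bracket_anticommute: "bracket x y + bracket y x = 0"
  using bracket_self[of "x + y"] unfolding bracket_add_left bracket_add_right
  by (simp add: bracket_self add.commute)

text \<open>A central \<open>z\<close> satisfies \<open>bracket z x = 0\<close>, while membership in
  \<open>lie_centralizer bracket x\<close> asks for \<open>bracket x z = 0\<close>; this bridges the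
  two.\<close>

lemma bracket_eq_0_commute: "bracket x y = 0 \<longleftrightarrow> bracket y x = 0"
  using bracket_anticommute[of x y] by auto

lemma subspace_centralizer: "subspace (lie_centralizer bracket x)"
  by (simp add: subspace_def lie_centralizer_def bracket_add_right bracket_scale_right)

lemma subspace_center: "subspace (lie_center bracket)"
  by (simp add: subspace_def lie_center_def bracket_add_left bracket_scale_left)

lemma centralizer_psubset_UNIV:
  assumes "x \<notin> lie_center bracket"
  shows "lie_centralizer bracket x \<subset> UNIV"
  using assms by (auto simp: lie_center_def lie_centralizer_def)

lemma center_psubset_centralizer:
  assumes "x \<notin> lie_center bracket"
  shows "lie_center bracket \<subset> lie_centralizer bracket x"
proof -
  have "lie_center bracket \<subseteq> lie_centralizer bracket x"
    using bracket_eq_0_commute by (auto simp: lie_center_def lie_centralizer_def)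
  moreover have "x \<in> lie_centralizer bracket x"
    by (simp add: lie_centralizer_def bracket_self)
  ultimately show ?thesis
    using assms by blast
qed

lemma card_centralizer_le:
  assumes "finite (UNIV :: 'a set)" and "x \<notin> lie_center bracket"
  shows "card (UNIV :: 'k set) * card (lie_centralizer bracket x) \<le> card (UNIV :: 'a set)"
  using assms centralizer_psubset_UNIV
  by (intro card_proper_subspace_le subspace_centralizer) auto

text \<open>Each strict inclusion in the chain from the center through the centralizer of a
  non-central \<open>x\<close> to \<open>UNIV\<close> contributes one factor of the field
  size.\<close>

lemma card_center_le:
  assumes fin: "finite (UNIV :: 'a set)" and "\<not> lie_abelian bracket"
  shows "card (UNIV :: 'k set) ^ 2 * card (lie_center bracket) \<le> card (UNIV :: 'a set)"
proof -
  obtain x where x: "x \<notin> lie_center bracket"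
    using assms(2) by (auto simp: lie_abelian_def lie_center_def)
  have "card (UNIV :: 'k set) * card (lie_center bracket) \<le> card (lie_centralizer bracket x)"
    using center_psubset_centralizer[OF x] finite_subset[OF subset_UNIV fin]
    by (intro card_proper_subspace_le subspace_center subspace_centralizer)
  then have "card (UNIV :: 'k set) * (card (UNIV :: 'k set) * card (lie_center bracket))
      \<le> card (UNIV :: 'k set) * card (lie_centralizer bracket x)"
    by (rule mult_le_mono2)
  also have "\<dots> \<le> card (UNIV :: 'a set)"
    by (rule card_centralizer_le[OF fin x])
  finally show ?thesis
    by (simp add: power2_eq_square mult.assoc)
qed

text \<open>The factor \<open>q\<close> on the left replaces a division by \<open>q\<close>, so the
  count stays in the natural numbers.\<close>

lemma card_commuting_pairs_le:
  assumes fin: "finite (UNIV :: 'a set)"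
  defines "q \<equiv> card (UNIV :: 'k set)" and "N \<equiv> card (UNIV :: 'a set)"
    and "Z \<equiv> lie_center bracket"
  shows "q * card {(x, y). bracket x y = 0} \<le> q * (card Z * N) + (N - card Z) * N"
proof -
  have finite: "finite A" for A :: "'a set"
    using fin by (rule rev_finite_subset) simp
  have "{(x, y). bracket x y = 0} = (SIGMA x:UNIV. lie_centralizer bracket x)"
    by (auto simp: lie_centralizer_def)
  then have "card {(x, y). bracket x y = 0} = (\<Sum>x\<in>UNIV. card (lie_centralizer bracket x))"
    by (simp add: card_SigmaI finite)
  also have "\<dots> = (\<Sum>x\<in>Z. card (lie_centralizer bracket x))
      + (\<Sum>x\<in>- Z. card (lie_centralizer bracket x))"
    by (metis Compl_eq_Diff_UNIV add.commute fin subset_UNIV sum.subset_diff)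
  finally have "q * card {(x, y). bracket x y = 0} =
      q * (\<Sum>x\<in>Z. card (lie_centralizer bracket x))
      + (\<Sum>x\<in>- Z. q * card (lie_centralizer bracket x))"
    by (simp add: distrib_left sum_distrib_left)
  \<comment> \<open>For central \<open>x\<close> the bound \<open>N\<close> is sharp; for the other
    \<open>x\<close> the factor \<open>q\<close> is absorbed by
    \<open>card_centralizer_le\<close>.\<close>
  also have "\<dots> \<le> q * (\<Sum>x\<in>Z. N) + (\<Sum>x\<in>- Z. N)"
    unfolding q_def N_def Z_def
    by (intro add_mono mult_le_mono2 sum_mono card_mono fin subset_UNIV card_centralizer_le) auto
  also have "\<dots> = q * (card Z * N) + (N - card Z) * N"
    by (simp add: N_def card_Diff_subset finite Compl_eq_Diff_UNIV)
  finally show ?thesis .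
qed

end

theorem theorem4p2:
  fixes scale :: "'k::{field,finite} \<Rightarrow> 'a::ab_group_add \<Rightarrow> 'a"
    and bracket :: "'a \<Rightarrow> 'a \<Rightarrow> 'a"
    and q :: nat
  assumes q: "q = card (UNIV :: 'k set)"
    and lie: "lie_algebra scale bracket"
    and fin_dim: "\<exists>B. finite_dimensional_vector_space scale B"
    and non_abelian: "\<not> lie_abelian bracket"
    and dim_center: "vector_space.dim scale (lie_center bracket) \<ge> 1"
  shows "commutativity_degree bracket \<le> (real q ^ 2 + real q - 1) / real q ^ 3"
proof -
  interpret lie_algebra scale bracket
    by (rule lie)
  have q_pos: "real q \<ge> 1"
    using q by (simp add: Suc_le_eq card_gt_0_iff)
  show ?thesis
  proof (cases "finite (UNIV :: 'a set)")
    case False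
    \<comment> \<open>Here \<open>card UNIV = 0\<close>, so the degree is the junk value \<open>_ / 0 = 0\<close>.\<close>
    then have "commutativity_degree bracket = 0"
      by (simp add: commutativity_degree_def)
    then show ?thesis
      using q_pos by (simp add: add_increasing)
  next
    case True
    define N where "N = real (card (UNIV :: 'a set))"
    define z where "z = real (card (lie_center bracket))"
    define K where "K = real (card {(x, y). bracket x y = 0})"
    have N_pos: "N > 0"
      using True by (simp add: N_def card_gt_0_iff)
    \<comment> \<open>This makes the truncated subtraction in \<open>card_commuting_pairs_le\<close>
      agree with \<open>N - z\<close> over the reals.\<close>
    have z_le: "card (lie_center bracket) \<le> card (UNIV :: 'a set)"
      using True by (simp add: card_mono)
    have center: "real q ^ 2 * z \<le> N"
      using card_center_le[OF True non_abelian, folded q]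
      unfolding N_def z_def by (metis of_nat_le_iff of_nat_mult of_nat_power)
    have pairs: "real q * K \<le> real q * (z * N) + (N - z) * N"
      using of_nat_mono[OF card_commuting_pairs_le[OF True, folded q], where 'a = real] z_le
      by (simp add: N_def z_def K_def of_nat_diff)
    \<comment> \<open>Of the three factors \<open>q\<close>, one serves \<open>pairs\<close> and the
      other two serve \<open>center\<close>.\<close>
    have "K * real q ^ 3 = real q ^ 2 * (real q * K)"
      by (simp add: power3_eq_cube power2_eq_square)
    also have "\<dots> \<le> real q ^ 2 * (real q * (z * N) + (N - z) * N)"
      using pairs by (rule mult_left_mono) simp
    \<comment> \<open>Once the terms in \<open>z\<close> are collected, their coefficient is
      non-negative because \<open>q\<close> is at least 1, so the upper bound on \<open>z\<close>
      can be inserted.\<close>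
    also have "\<dots> = real q ^ 2 * N ^ 2 + (real q - 1) * N * (real q ^ 2 * z)"
      by (simp add: algebra_simps power2_eq_square)
    also have "\<dots> \<le> real q ^ 2 * N ^ 2 + (real q - 1) * N * N"
      using center q_pos N_pos by (intro add_left_mono mult_left_mono) auto
    also have "\<dots> = (real q ^ 2 + real q - 1) * N ^ 2"
      by (simp add: algebra_simps power2_eq_square)
    finally have "K / N ^ 2 \<le> (real q ^ 2 + real q - 1) / real q ^ 3"
      using N_pos q_pos by (simp add: divide_simps)
    then show ?thesis
      by (simp add: commutativity_degree_def K_def N_def)
  qed
qed

end
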